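(* Suppose that for all $t=1,2,\dots$ the network $\mathbb{G}(t)$ of $m$ normal agents has a fully connected sub-graph $\mathbb{F}$ (time-invariant; complete, i.e. every agent of $\mathbb{F}$ has incoming edges from all other agents of $\mathbb{F}$) whose number of agents satisfies $|\mathscr{V}(\mathbb{F})|=f\ge 2n\bar\kappa+1$. Suppose further that every (nonempty) subset of $\mathscr{V}(\mathbb{G}(t))\setminus\mathscr{V}(\mathbb{F})$ is $(n\bar\kappa+1)$-reachable in $\mathbb{G}(t)$. Let $\mathbb{G}(t)$ be under Byzantine attack such that at each time step each normal agent $i$ has $\kappa_i(t)\le\bar\kappa$ additional Byzantine neighbors ($\bar\kappa\in\mathbb{Z}_+$), and let each normal agent run Algorithm 1 (see context) with $\sigma_i(t)=n\kappa_i(t)+2$. Then the following network redundancy condition holds with $\varphi=f-n\bar\kappa$: for all $t=1,2,\dots$ the graph $\mathbb{N}(t)$ (see context) is a rooted directed graph, i.e. it contains at least one agent from which every other agent can be reached by a directed path; and, with $\mathbb{S}(t)$ denoting the root strongly connected component of $\mathbb{N}(t)$, there exists an infinite sequence of contiguous uniformly bounded time intervals such that in every interval $|\mathscr{V}(\mathbb{S}(t))|\ge\varphi$ for at least one time step $t$.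
   Context: Network. Normal agents are $1,\dots,m$ with states $x_i(t)\in\mathbb{R}^n$; $\mathbb{G}(t)$ is a directed graph on them, with an edge from $j$ to $i$ iff $j\in\mathcal{N}_i(t)$ (the normal neighbors of $i$), and $i\in\mathcal{N}_i(t)$ always. $\mathcal{M}_i(t)$ is the set of Byzantine neighbors of $i$, $|\mathcal{M}_i(t)|=\kappa_i(t)$; they send arbitrary vectors in $\mathbb{R}^n$, possibly different ones to different normal agents. $\mathcal{N}_i^+(t)=\mathcal{N}_i(t)\cup\mathcal{M}_i(t)$, $d_i(t)=|\mathcal{N}_i^+(t)|$. $\mathscr{V}(\cdot)$ denotes the vertex set of a graph. For a finite set of agents $\mathcal{A}$, $x_{\mathcal{A}}=\{x_j:j\in\mathcal{A}\}$ and $\mathcal{H}(x_{\mathcal{A}})$ is its convex hull; for a Byzantine neighbor, $x_j$ means the value it sent to agent $i$. Normal agents update by $x_i(t+1)=\mathcal{P}_i(v_i^\star(t))$, where $\mathcal{P}_i$ is the projection onto a local convex constraint set and $v_i^\star(t)$ is the output of Algorithm 1. $r$-reachable set: a nonempty subset $\mathcal{A}_s$ of the vertices of a directed graph is $r$-reachable if there is $i\in\mathcal{A}_s$ with $|\mathcal{N}_i\setminus\mathcal{A}_s|\ge r$. Algorithm 1 (for agent $i$ at a given time; input $\mathcal{N}_i^+$, $x_{\mathcal{N}_i^+}$, $\kappa_i$). Choose an integer $\sigma_i\in[n\kappa_i+2,\,d_i-\kappa_i]$. Let $s_i=\binom{d_i-1}{\sigma_i-1}$ and let $\mathcal{S}_{ij}$,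 $j=1,\dots,s_i$, be all subsets of $\mathcal{N}_i^+$ with $i\in\mathcal{S}_{ij}$ and $|\mathcal{S}_{ij}|=\sigma_i$. For each $j$ put $\widehat{\mathcal{S}}_{ij}=\mathcal{S}_{ij}\setminus\{i\}$. If $x_i\in\mathcal{H}(x_{\widehat{\mathcal{S}}_{ij}})$, let $\phi_{ij}=x_i$. Otherwise let $b_i=\binom{\sigma_i-1}{\kappa_i}$, let $\mathcal{B}_{ijk}$, $k=1,\dots,b_i$, be all subsets of $\mathcal{S}_{ij}$ with $i\in\mathcal{B}_{ijk}$ and $|\mathcal{B}_{ijk}|=\sigma_i-\kappa_i$, and let $\phi_{ij}$ be any point of $\left(\bigcap_{k=1}^{b_i}\mathcal{H}(x_{\mathcal{B}_{ijk}})\right)\cap\mathcal{H}(x_{\widehat{\mathcal{S}}_{ij}})$ (this set is non-empty). Output $v_i^\star=\frac{1}{s_i+1}\left(x_i+\sum_{j=1}^{s_i}\phi_{ij}\right)$. Graphs $\widehat{\mathbb{G}}(t)$ and $\mathbb{N}(t)$. With $\sigma_i(t)=n\kappa_i(t)+2$, put $\gamma_i(t)=d_i(t)-\kappa_i(t)-\sigma_i(t)+2$ and $\alpha_i(t)=\frac{1}{(s_i(t)+1)(n+1)}$. The output satisfies $v_i^\star(t)=\sum_{j\in\mathcal{N}_i(t)}w_{ij}^\star(t)x_j(t)$ for some weights $w^\star_{ij}(t)\in[0,1]$ summing to $1$, at least $\gamma_i(t)$ of which are $\ge\alpha_i(t)$; fix such weights for every $i,t$. $\widehat{\mathbb{G}}(t)$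 is the weighted graph on $\{1,\dots,m\}$ whose edge from $j$ to $i$ has weight $w_{ij}^\star(t)$ (a sub-graph of $\mathbb{G}(t)$). Let $\underline\alpha=\min_{i,t}\alpha_i(t)$, which exists and is positive since $s_i(t)$ is bounded. $\mathbb{N}(t)$ is the directed graph with the same vertex set whose edges are the edges of $\widehat{\mathbb{G}}(t)$ with weight at least $\underline\alpha$. The root strongly connected component of a rooted graph is the strongly connected component consisting of its roots. *)

theory Defs
  imports "HOL-Analysis.Analysis" "Graph_Theory.Pair_Digraph" "Graph_Theory.Digraph_Component"
begin

text \<open>An arc \<open>(j, i)\<close> runs from \<open>j\<close> to \<open>i\<close>, that is, \<open>i\<close> receives information from \<open>j\<close>.\<close>

definition in_neighbors :: "('a, 'b) pre_digraph \<Rightarrow> 'a \<Rightarrow> 'a set" where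
  "in_neighbors G i = {j. j \<rightarrow>\<^bsub>G\<^esub> i}"

definition fully_connected :: "('a, 'b) pre_digraph \<Rightarrow> bool" where
  "fully_connected G \<longleftrightarrow> (\<forall>i\<in>verts G. \<forall>j\<in>verts G. j \<noteq> i \<longrightarrow> j \<rightarrow>\<^bsub>G\<^esub> i)"

text \<open>
  In the next definition \<open>reachable\<close> refers to information entering the set \<open>A\<close> from outside;
  it is unrelated to \<^const>\<open>reachable\<close>.
\<close>

definition r_reachable_set :: "nat \<Rightarrow> ('a, 'b) pre_digraph \<Rightarrow> 'a set \<Rightarrow> bool" where
  "r_reachable_set r G A \<longleftrightarrow>
     A \<noteq> {} \<and> A \<subseteq> verts G \<and> (\<exists>i\<in>A. r \<le> card (in_neighbors G i - A))"

definition roots :: "('a, 'b) pre_digraph \<Rightarrow> 'a set" where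
  "roots G = {r \<in> verts G. \<forall>v\<in>verts G. r \<rightarrow>\<^sup>*\<^bsub>G\<^esub> v}"

definition rooted :: "('a, 'b) pre_digraph \<Rightarrow> bool" where
  "rooted G \<longleftrightarrow> roots G \<noteq> {}"

definition root_scc :: "('a, 'b) pre_digraph \<Rightarrow> ('a, 'b) pre_digraph" where
  "root_scc G = G \<restriction> roots G"

lemma root_scc_in_sccs:
  assumes "wf_digraph G" and "rooted G"
  shows "root_scc G \<in> pre_digraph.sccs G"
proof -
  interpret wf_digraph G by fact
  have "roots G \<in> sccs_verts"
    unfolding in_sccs_verts_conv_reachable
  proof (intro conjI ballI allI impI)
    show "roots G \<noteq> {}" using assms(2) by (simp add: rooted_def)
    show "u \<rightarrow>\<^sup>*\<^bsub>G\<^esub> v" if "u \<in> roots G" "v \<in> roots G" for u v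
      using that unfolding roots_def by blast
    show "\<not> u \<rightarrow>\<^sup>*\<^bsub>G\<^esub> v \<or> \<not> v \<rightarrow>\<^sup>*\<^bsub>G\<^esub> u" if u: "u \<in> roots G" and v: "v \<notin> roots G" for u v
    proof (rule disjI2, rule notI)
      assume vu: "v \<rightarrow>\<^sup>*\<^bsub>G\<^esub> u"
      have "v \<rightarrow>\<^sup>*\<^bsub>G\<^esub> x" if "x \<in> verts G" for x
      proof (rule reachable_trans[OF vu])
        show "u \<rightarrow>\<^sup>*\<^bsub>G\<^esub> x" using u that unfolding roots_def by blast
      qed
      moreover have "v \<in> verts G" using vu by (rule reachable_in_verts)
      ultimately show False using v unfolding roots_def by blast
    qed
  qed
  then show ?thesis unfolding root_scc_def by (rule in_verts_sccsD_sccs)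
qed

text \<open>
  The half-open intervals \<open>[\<tau> k, \<tau> (k + 1))\<close> are the contiguous time intervals; together
  they cover the time axis \<open>1, 2, \<dots>\<close>, and \<open>L\<close> bounds their lengths.
\<close>

definition network_redundancy :: "nat \<Rightarrow> (nat \<Rightarrow> ('a, 'b) pre_digraph) \<Rightarrow> bool" where
  "network_redundancy \<phi> H \<longleftrightarrow>
     (\<forall>t\<ge>1. rooted (H t)) \<and>
     (\<exists>\<tau> :: nat \<Rightarrow> nat. \<exists>L. \<tau> 0 = 1 \<and> strict_mono \<tau> \<and>
        (\<forall>k. \<tau> (Suc k) - \<tau> k \<le> L) \<and>
        (\<forall>k. \<exists>t\<in>{\<tau> k..<\<tau> (Suc k)}. \<phi> \<le> card (verts (root_scc (H t)))))"

text \<open>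
  One step of the algorithm for agent \<open>i\<close>: \<open>N\<close> is the set of all its neighbors (normal ones,
  including \<open>i\<close>, and Byzantine ones), \<open>y j\<close> is the state available from neighbor \<open>j\<close>,
  \<open>\<kappa>\<close> is the number of Byzantine neighbors. The algorithm leaves a choice, so its outcomes are
  described by predicates. The index \<open>j\<close> of the sets \<open>S\<^sub>i\<^sub>j\<close> is replaced by the set itself.
\<close>

definition selections :: "'a \<Rightarrow> 'a set \<Rightarrow> nat \<Rightarrow> 'a set set" where
  "selections i N k = {S. S \<subseteq> N \<and> i \<in> S \<and> card S = k}"

definition selection_point ::
  "'a \<Rightarrow> ('a \<Rightarrow> real ^ 'n) \<Rightarrow> nat \<Rightarrow> 'a set \<Rightarrow> real ^ 'n \<Rightarrow> bool" where
  "selection_point i y \<kappa> S p \<longleftrightarrow>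
     (if y i \<in> convex hull (y ` (S - {i})) then p = y i
      else p \<in> (\<Inter>B\<in>selections i S (card S - \<kappa>). convex hull (y ` B))
               \<inter> convex hull (y ` (S - {i})))"

definition num_selections :: "nat \<Rightarrow> nat \<Rightarrow> nat" where
  "num_selections d \<sigma> = (d - 1) choose (\<sigma> - 1)"

definition algorithm_output ::
  "'a \<Rightarrow> 'a set \<Rightarrow> ('a \<Rightarrow> real ^ 'n) \<Rightarrow> nat \<Rightarrow> nat \<Rightarrow> real ^ 'n \<Rightarrow> bool" where
  "algorithm_output i N y \<kappa> \<sigma> v \<longleftrightarrow>
     CARD('n) * \<kappa> + 2 \<le> \<sigma> \<and> \<sigma> + \<kappa> \<le> card N \<and>
     (\<exists>p. (\<forall>S\<in>selections i N \<sigma>. selection_point i y \<kappa> S (p S)) \<and>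
          v = (1 / (real (num_selections (card N) \<sigma>) + 1)) *\<^sub>R
              (y i + (\<Sum>S\<in>selections i N \<sigma>. p S)))"

definition gamma_bound :: "nat \<Rightarrow> nat \<Rightarrow> nat \<Rightarrow> int" where
  "gamma_bound d \<kappa> \<sigma> = int d - int \<kappa> - int \<sigma> + 2"

definition alpha_bound :: "nat \<Rightarrow> nat \<Rightarrow> nat \<Rightarrow> real" where
  "alpha_bound n d \<sigma> = 1 / ((real (num_selections d \<sigma>) + 1) * (real n + 1))"

definition output_weights ::
  "'a set \<Rightarrow> ('a \<Rightarrow> real ^ 'n) \<Rightarrow> real ^ 'n \<Rightarrow> int \<Rightarrow> real \<Rightarrow> ('a \<Rightarrow> real) \<Rightarrow> bool" where
  "output_weights N x v \<gamma> \<alpha> w \<longleftrightarrow>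
     v = (\<Sum>j\<in>N. w j *\<^sub>R x j) \<and> (\<forall>j\<in>N. 0 \<le> w j \<and> w j \<le> 1) \<and> (\<Sum>j\<in>N. w j) = 1 \<and>
     \<gamma> \<le> int (card {j \<in> N. \<alpha> \<le> w j})"

text \<open>
  Normal agents are \<open>1, \<dots>, m\<close>; Byzantine agents carry labels outside \<open>{1..m}\<close>.
  \<open>Nb i t\<close> and \<open>Byz i t\<close> are the sets of normal and Byzantine neighbors of \<open>i\<close> at time \<open>t\<close>,
  \<open>x i t\<close> is the state of the normal agent \<open>i\<close>, and \<open>z i j t\<close> is the vector that the Byzantine
  agent \<open>j\<close> sends to \<open>i\<close>.
\<close>

definition received ::
  "nat \<Rightarrow> (nat \<Rightarrow> nat \<Rightarrow> real ^ 'n) \<Rightarrow> (nat \<Rightarrow> nat \<Rightarrow> nat \<Rightarrow> real ^ 'n) \<Rightarrow>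
   nat \<Rightarrow> nat \<Rightarrow> nat \<Rightarrow> real ^ 'n" where
  "received m x z i t j = (if j \<in> {1..m} then x j t else z i j t)"

definition all_neighbors ::
  "(nat \<Rightarrow> nat \<Rightarrow> nat set) \<Rightarrow> (nat \<Rightarrow> nat \<Rightarrow> nat set) \<Rightarrow> nat \<Rightarrow> nat \<Rightarrow> nat set" where
  "all_neighbors Nb Byz i t = Nb i t \<union> Byz i t"

definition normal_graph ::
  "nat \<Rightarrow> (nat \<Rightarrow> nat \<Rightarrow> nat set) \<Rightarrow> nat \<Rightarrow> (nat, nat \<times> nat) pre_digraph" where
  "normal_graph m Nb t =
     with_proj \<lparr>pverts = {1..m}, parcs = {(j, i). i \<in> {1..m} \<and> j \<in> Nb i t}\<rparr>"

text \<open>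
  The weighted graph of the algorithm has an arc \<open>(j, i)\<close> of weight \<open>w i t j\<close> for every neighbor
  \<open>j\<close> of \<open>i\<close> with non-zero weight. The redundancy graph keeps the arcs of weight at least
  \<open>alpha_min\<close>, the minimum of \<open>alpha_bound\<close> over all agents and times.
\<close>

definition weighted_graph ::
  "nat \<Rightarrow> (nat \<Rightarrow> nat \<Rightarrow> nat set) \<Rightarrow> (nat \<Rightarrow> nat \<Rightarrow> nat \<Rightarrow> real) \<Rightarrow> nat \<Rightarrow>
   (nat, nat \<times> nat) pre_digraph" where
  "weighted_graph m Nb w t =
     with_proj \<lparr>pverts = {1..m}, parcs = {(j, i). i \<in> {1..m} \<and> j \<in> Nb i t \<and> w i t j \<noteq> 0}\<rparr>"

definition alpha_min ::
  "nat \<Rightarrow> nat \<Rightarrow> (nat \<Rightarrow> nat \<Rightarrow> nat set) \<Rightarrow> (nat \<Rightarrow> nat \<Rightarrow> nat set) \<Rightarrow> (nat \<Rightarrow> nat \<Rightarrow> nat) \<Rightarrow> real"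
  where
  "alpha_min n m Nb Byz \<sigma> =
     Min {alpha_bound n (card (all_neighbors Nb Byz i t)) (\<sigma> i t) | i t. i \<in> {1..m} \<and> 1 \<le> t}"

definition redundancy_graph ::
  "real \<Rightarrow> nat \<Rightarrow> (nat \<Rightarrow> nat \<Rightarrow> nat set) \<Rightarrow> (nat \<Rightarrow> nat \<Rightarrow> nat \<Rightarrow> real) \<Rightarrow> nat \<Rightarrow>
   (nat, nat \<times> nat) pre_digraph" where
  "redundancy_graph a m Nb w t =
     with_proj \<lparr>pverts = {1..m},
                parcs = {(j, i) \<in> arcs (weighted_graph m Nb w t). a \<le> w i t j}\<rparr>"

text \<open>
  The minimum \<open>alpha_min\<close> exists when the numbers of neighbors are bounded.
\<close>

lemma finite_alpha_values:
  assumes "\<And>i t. i \<in> {1..m} \<Longrightarrow> 1 \<le> t \<Longrightarrow> card (all_neighbors Nb Byz i t) \<le> D"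
    and "\<And>i t. i \<in> {1..m} \<Longrightarrow> 1 \<le> t \<Longrightarrow> \<sigma> i t \<le> card (all_neighbors Nb Byz i t)"
  shows "finite {alpha_bound n (card (all_neighbors Nb Byz i t)) (\<sigma> i t) | i t.
    i \<in> {1..m} \<and> 1 \<le> t}"
proof (rule finite_subset)
  show "{alpha_bound n (card (all_neighbors Nb Byz i t)) (\<sigma> i t) | i t. i \<in> {1..m} \<and> 1 \<le> t}
    \<subseteq> (\<lambda>(d, s). alpha_bound n d s) ` ({..D} \<times> {..D})"
  proof
    fix a
    assume "a \<in> {alpha_bound n (card (all_neighbors Nb Byz i t)) (\<sigma> i t) | i t. i \<in> {1..m} \<and> 1 \<le> t}"
    then obtain i t where it: "i \<in> {1..m}" "1 \<le> t"
      and a: "a = alpha_bound n (card (all_neighbors Nb Byz i t)) (\<sigma> i t)"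
      by blast
    have "(card (all_neighbors Nb Byz i t), \<sigma> i t) \<in> {..D} \<times> {..D}"
      using assms(1)[OF it] assms(2)[OF it] by simp
    then show "a \<in> (\<lambda>(d, s). alpha_bound n d s) ` ({..D} \<times> {..D})"
      unfolding a by (rule rev_image_eqI) simp
  qed
qed simp

text \<open>
  The point \<open>y\<close> is the Euclidean projection of \<open>v\<close> onto \<open>C\<close>. For closed, convex, non-empty \<open>C\<close>
  this is \<open>y = closest_point C v\<close>; in general it also asserts that the projection exists.
\<close>

definition is_projection :: "(real ^ 'n) set \<Rightarrow> real ^ 'n \<Rightarrow> real ^ 'n \<Rightarrow> bool" where
  "is_projection C v y \<longleftrightarrow> y \<in> C \<and> (\<forall>u\<in>C. dist v y \<le> dist v u)"

end

theory Submission
  imports Defs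
begin

text \<open>
  Since \<open>d\<^sub>i\<close> counts the Byzantine neighbors, \<open>\<gamma>\<^sub>i = |N\<^sub>i| - n \<kappa>\<^sub>i\<close>, so passing from the normal graph
  to the redundancy graph costs every agent at most \<open>K = n \<kappa>bar\<close> of its normal in-neighbors. Call a
  non-empty vertex set in-closed if it contains all in-neighbors of its members. By reachability
  of the sets outside the core, an in-closed set of the redundancy graph meets the core, and then
  it contains at least \<open>f - K\<close> core agents. As \<open>f > 2 K\<close>, any two in-closed sets intersect, so
  a minimal in-closed set lies inside every other one, in particular inside the set
  of agents from which a given agent can be reached: it consists of roots.
\<close>

section \<open>In-closed sets and roots\<close>

definition in_closed :: "('a, 'b) pre_digraph \<Rightarrow> 'a set \<Rightarrow> bool" where
  "in_closed G A \<longleftrightarrow> A \<noteq> {} \<and> A \<subseteq> verts G \<and> (\<forall>i\<in>A. in_neighbors G i \<subseteq> A)"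

text \<open>An arc put in front of a walk to \<open>v\<close> gives another walk to
  \<open>v\<close>; the trivial walk at \<open>v\<close> provides non-emptiness.\<close>

lemma in_closed_reaching:
  assumes "wf_digraph G" and v: "v \<in> verts G"
  shows "in_closed G {u. u \<rightarrow>\<^sup>*\<^bsub>G\<^esub> v}"
proof -
  interpret wf_digraph G by fact
  show ?thesis
    unfolding in_closed_def in_neighbors_def
    using v by (auto dest: reachable_in_verts intro: adj_reachable_trans)
qed

lemma in_closed_subset_roots:
  assumes wf: "wf_digraph G" and fin: "finite (verts G)" and ne: "verts G \<noteq> {}"
    and meet: "\<And>A B. in_closed G A \<Longrightarrow> in_closed G B \<Longrightarrow> A \<inter> B \<noteq> {}"
  obtains R where "in_closed G R" and "R \<subseteq> roots G"
proof -
  interpret wf_digraph G by (rule wf)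
  let ?C = "{A. in_closed G A}"
  have "finite ?C"
    by (rule finite_subset[of _ "Pow (verts G)"]) (use fin in \<open>auto simp: in_closed_def\<close>)
  moreover have "in_closed G (verts G)"
    using ne by (auto simp: in_closed_def in_neighbors_def)
  ultimately obtain R where R: "in_closed G R"
    and min: "\<And>A. in_closed G A \<Longrightarrow> A \<subseteq> R \<Longrightarrow> R = A"
    using finite_has_minimal[of ?C] by blast
  have "r \<rightarrow>\<^sup>*\<^bsub>G\<^esub> v" if r: "r \<in> R" and v: "v \<in> verts G" for r v
  proof -
    let ?P = "{u. u \<rightarrow>\<^sup>*\<^bsub>G\<^esub> v}"
    have P: "in_closed G ?P"
      using wf v by (rule in_closed_reaching)
    \<comment> \<open>Non-emptiness is the one clause that an intersection does not inherit;
      \<open>meet\<close> supplies it.\<close>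
    have "in_closed G (R \<inter> ?P)"
      using R P meet[OF R P] unfolding in_closed_def by blast
    then have "R = R \<inter> ?P"
      by (rule min) simp
    then show ?thesis using r by blast
  qed
  then have "R \<subseteq> roots G"
    using R unfolding roots_def in_closed_def by blast
  with R show thesis by (rule that)
qed

text \<open>The combinatorial core, free of weights and time: \<open>H\<close> is compared with
  \<open>G\<close> only through in-neighbors, and \<open>K\<close> bounds the loss at each vertex.
  \<open>C\<close> is the complete core.\<close>

lemma large_root_set:
  fixes G :: "('a, 'b) pre_digraph" and H :: "('a, 'c) pre_digraph"
  assumes wf: "wf_digraph H" and fin: "finite (verts H)" and verts_eq: "verts G = verts H"
    and fin_nb: "\<And>i. i \<in> verts H \<Longrightarrow> finite (in_neighbors G i)"
    and loss: "\<And>i. i \<in> verts H \<Longrightarrow> card (in_neighbors G i - in_neighbors H i) \<le> K"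
    and C: "C \<subseteq> verts H" "\<And>i. i \<in> C \<Longrightarrow> C \<subseteq> insert i (in_neighbors G i)"
    and C_card: "2 * K < card C"
    and outside: "\<And>A. A \<noteq> {} \<Longrightarrow> A \<subseteq> verts H - C \<Longrightarrow> r_reachable_set (K + 1) G A"
  shows "rooted H" and "card C - K \<le> card (roots H)"
proof -
  have fin_C: "finite C"
    using C(1) fin by (rule finite_subset)
  have big: "card C - K \<le> card (A \<inter> C)" if A: "in_closed H A" for A
  proof -
    have "A \<inter> C \<noteq> {}"
    proof
      assume "A \<inter> C = {}"
      with A have "r_reachable_set (K + 1) G A"
        by (intro outside) (auto simp: in_closed_def)
      then obtain i where i: "i \<in> A" "K + 1 \<le> card (in_neighbors G i - A)"
        unfolding r_reachable_set_def by blast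
      then have iV: "i \<in> verts H" "in_neighbors H i \<subseteq> A"
        using A unfolding in_closed_def by blast+
      have "card (in_neighbors G i - A) \<le> card (in_neighbors G i - in_neighbors H i)"
        using iV fin_nb by (intro card_mono) auto
      with loss[OF iV(1)] i(2) show False by simp
    qed
    then obtain i where i: "i \<in> A" "i \<in> C" by blast
    then have iV: "i \<in> verts H" "in_neighbors H i \<subseteq> A"
      using A unfolding in_closed_def by blast+
    let ?L = "in_neighbors G i - in_neighbors H i"
    \<comment> \<open>In \<open>G\<close> the core agent \<open>i\<close> hears from every other
      core agent; those not lost are in-neighbors in \<open>H\<close> and hence in
      \<open>A\<close>.\<close>
    have "C - ?L \<subseteq> A \<inter> C"
      using C(2)[OF i(2)] i iV by blast
    then have "card (C - ?L) \<le> card (A \<inter> C)"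
      using fin_C by (intro card_mono) auto
    moreover have "card C - card ?L \<le> card (C - ?L)"
      using fin_nb[OF iV(1)] by (intro diff_card_le_card_Diff) auto
    ultimately show ?thesis
      using loss[OF iV(1)] by linarith
  qed
  \<comment> \<open>Disjoint \<open>A\<close> and \<open>B\<close> would require
    \<open>2 * (card C - K)\<close> core agents, which exceeds \<open>card C\<close> because
    \<open>2 * K < card C\<close>.\<close>
  have meet: "A \<inter> B \<noteq> {}" if "in_closed H A" "in_closed H B" for A B
  proof
    assume "A \<inter> B = {}"
    then have "card (A \<inter> C) + card (B \<inter> C) = card ((A \<inter> C) \<union> (B \<inter> C))"
      using fin_C by (intro card_Un_disjoint[symmetric]) auto
    also have "\<dots> \<le> card C"
      using fin_C by (intro card_mono) auto
    finally show False
      using big[OF that(1)] big[OF that(2)] C_card by linarith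
  qed
  have "C \<noteq> {}"
    using C_card by auto
  then have "verts H \<noteq> {}"
    using C(1) by blast
  then obtain R where R: "in_closed H R" "R \<subseteq> roots H"
    using in_closed_subset_roots[OF wf fin _ meet] by blast
  then show "rooted H"
    unfolding rooted_def in_closed_def by blast
  have "finite (roots H)"
    using fin unfolding roots_def by simp
  then have "card (R \<inter> C) \<le> card (roots H)"
    using R(2) by (intro card_mono) auto
  with big[OF R(1)] show "card C - K \<le> card (roots H)" by linarith
qed

section \<open>From root sets to the redundancy condition\<close>

lemma verts_root_scc [simp]: "verts (root_scc G) = roots G"
  by (simp add: root_scc_def)

lemma network_redundancy_every_time:
  assumes "\<And>t. 1 \<le> t \<Longrightarrow> rooted (H t)" and "\<And>t. 1 \<le> t \<Longrightarrow> \<phi> \<le> card (roots (H t))"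
  shows "network_redundancy \<phi> H"
  unfolding network_redundancy_def
proof (intro conjI)
  show "\<exists>\<tau> :: nat \<Rightarrow> nat. \<exists>L. \<tau> 0 = 1 \<and> strict_mono \<tau> \<and> (\<forall>k. \<tau> (Suc k) - \<tau> k \<le> L) \<and>
      (\<forall>k. \<exists>t\<in>{\<tau> k..<\<tau> (Suc k)}. \<phi> \<le> card (verts (root_scc (H t))))"
    \<comment> \<open>Every time step qualifies, so intervals of length 1 suffice:
      \<open>Suc\<close> starts at 1 and the interval with index \<open>k\<close> contains only the
      time \<open>Suc k\<close>.\<close>
    using assms(2) by (intro exI[of _ Suc] exI[of _ 1]) (auto simp: strict_mono_Suc_iff)
qed (use assms(1) in blast)

section \<open>The weight threshold and the lost neighbors\<close>

lemma alpha_bound_pos: "0 < alpha_bound n d s"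
  unfolding alpha_bound_def by (intro divide_pos_pos mult_pos_pos) linarith+

text \<open>The bound \<open>D\<close> leaves finitely many values and the pair \<open>i\<close>,
  \<open>t\<close> provides one, so \<open>Min\<close> is attained and inherits positivity.\<close>

lemma alpha_min_bounds:
  assumes "\<And>i t. i \<in> {1..m} \<Longrightarrow> 1 \<le> t \<Longrightarrow> card (all_neighbors Nb Byz i t) \<le> D"
    and "\<And>i t. i \<in> {1..m} \<Longrightarrow> 1 \<le> t \<Longrightarrow> \<sigma> i t \<le> card (all_neighbors Nb Byz i t)"
    and it: "i \<in> {1..m}" "1 \<le> t"
  shows "0 < alpha_min n m Nb Byz \<sigma>"
    and "alpha_min n m Nb Byz \<sigma> \<le> alpha_bound n (card (all_neighbors Nb Byz i t)) (\<sigma> i t)"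
proof -
  let ?V = "{alpha_bound n (card (all_neighbors Nb Byz i t)) (\<sigma> i t) | i t. i \<in> {1..m} \<and> 1 \<le> t}"
  have fin: "finite ?V"
    using assms(1,2) by (rule finite_alpha_values)
  have mem: "alpha_bound n (card (all_neighbors Nb Byz i t)) (\<sigma> i t) \<in> ?V"
    using it by blast
  have "\<forall>a\<in>?V. 0 < a"
    using alpha_bound_pos by blast
  then show "0 < alpha_min n m Nb Byz \<sigma>"
    unfolding alpha_min_def using Min_in[OF fin] mem by blast
  show "alpha_min n m Nb Byz \<sigma> \<le> alpha_bound n (card (all_neighbors Nb Byz i t)) (\<sigma> i t)"
    unfolding alpha_min_def using fin mem by (rule Min_le)
qed

lemma in_neighbors_normal_graph:
  "i \<in> {1..m} \<Longrightarrow> in_neighbors (normal_graph m Nb t) i = Nb i t"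
  by (auto simp: in_neighbors_def normal_graph_def arcs_ends_conv)

lemma in_neighbors_redundancy_graph:
  "i \<in> {1..m} \<Longrightarrow> in_neighbors (redundancy_graph a m Nb w t) i =
    {j \<in> Nb i t. w i t j \<noteq> 0 \<and> a \<le> w i t j}"
  by (auto simp: in_neighbors_def redundancy_graph_def weighted_graph_def arcs_ends_conv)

lemma wf_digraph_redundancy_graph:
  assumes "\<And>i. i \<in> {1..m} \<Longrightarrow> Nb i t \<subseteq> {1..m}"
  shows "wf_digraph (redundancy_graph a m Nb w t)"
proof
  fix e
  assume e: "e \<in> arcs (redundancy_graph a m Nb w t)"
  then have "snd e \<in> {1..m}" "fst e \<in> Nb (snd e) t"
    by (auto simp: redundancy_graph_def weighted_graph_def)
  with assms have "fst e \<in> {1..m}" by blast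
  with \<open>snd e \<in> {1..m}\<close> show "tail (redundancy_graph a m Nb w t) e \<in> verts (redundancy_graph a m Nb w t)"
    and "head (redundancy_graph a m Nb w t) e \<in> verts (redundancy_graph a m Nb w t)"
    by (simp_all add: redundancy_graph_def)
qed

text \<open>As \<open>a \<le> \<alpha>\<close>, the weights below \<open>a\<close> are disjoint from
  those of at least \<open>\<alpha>\<close>, whose number is at least
  \<open>card N - n * card B\<close>.\<close>

lemma output_weights_card_small:
  assumes ow: "output_weights N x v (gamma_bound (card (N \<union> B)) (card B) (n * card B + 2)) \<alpha> w"
    and fin: "finite N" "finite B" and disj: "N \<inter> B = {}" and a: "a \<le> \<alpha>"
  shows "card {j \<in> N. w j < a} \<le> n * card B"
proof -
  let ?U = "{j \<in> N. w j < a}"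
  let ?W = "{j \<in> N. \<alpha> \<le> w j}"
  \<comment> \<open>Disjointness gives \<open>card (N \<union> B) = card N + card B\<close>; in
    \<open>gamma_bound\<close> both \<open>card B\<close> and the constant 2 then cancel.\<close>
  have "int (card N) - int (n * card B) \<le> int (card ?W)"
    using ow card_Un_disjoint[OF fin disj] unfolding output_weights_def gamma_bound_def by simp
  moreover have "card ?U + card ?W = card (?U \<union> ?W)"
    using fin(1) a by (intro card_Un_disjoint[symmetric]) auto
  moreover have "card (?U \<union> ?W) \<le> card N"
    using fin(1) by (intro card_mono) auto
  ultimately show ?thesis by linarith
qed

section \<open>Application to the network under attack\<close>

theorem corollary1:
  fixes m \<kappa>bar f :: nat
    and Nb Byz :: "nat \<Rightarrow> nat \<Rightarrow> nat set"
    and x :: "nat \<Rightarrow> nat \<Rightarrow> real ^ 'n"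
    and z :: "nat \<Rightarrow> nat \<Rightarrow> nat \<Rightarrow> real ^ 'n"
    and X :: "nat \<Rightarrow> (real ^ 'n) set"
    and \<sigma> :: "nat \<Rightarrow> nat \<Rightarrow> nat"
    and v :: "nat \<Rightarrow> nat \<Rightarrow> real ^ 'n"
    and w :: "nat \<Rightarrow> nat \<Rightarrow> nat \<Rightarrow> real"
    and F :: "(nat, nat \<times> nat) pre_digraph"
  assumes neighbors: "\<forall>t\<ge>1. \<forall>i\<in>{1..m}. Nb i t \<subseteq> {1..m} \<and> i \<in> Nb i t"
    and byzantine: "\<forall>t\<ge>1. \<forall>i\<in>{1..m}.
      finite (Byz i t) \<and> Byz i t \<inter> {1..m} = {} \<and> card (Byz i t) \<le> \<kappa>bar"
    and core: "\<forall>t\<ge>1. subgraph F (normal_graph m Nb t)"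
    and core_complete: "fully_connected F"
    and core_card: "card (verts F) = f" "f \<ge> 2 * CARD('n) * \<kappa>bar + 1"
    and outside_core: "\<forall>t\<ge>1. \<forall>A. A \<noteq> {} \<and> A \<subseteq> verts (normal_graph m Nb t) - verts F \<longrightarrow>
      r_reachable_set (CARD('n) * \<kappa>bar + 1) (normal_graph m Nb t) A"
    and sigma: "\<forall>t\<ge>1. \<forall>i\<in>{1..m}. \<sigma> i t = CARD('n) * card (Byz i t) + 2"
    and algorithm: "\<forall>t\<ge>1. \<forall>i\<in>{1..m}.
      algorithm_output i (all_neighbors Nb Byz i t) (received m x z i t)
        (card (Byz i t)) (\<sigma> i t) (v i t)"
    and constraints: "\<forall>i\<in>{1..m}. convex (X i)"
    and update: "\<forall>t\<ge>1. \<forall>i\<in>{1..m}. is_projection (X i) (v i t) (x i (t + 1))"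
    and weights: "\<forall>t\<ge>1. \<forall>i\<in>{1..m}.
      output_weights (Nb i t) (\<lambda>j. x j t) (v i t)
        (gamma_bound (card (all_neighbors Nb Byz i t)) (card (Byz i t)) (\<sigma> i t))
        (alpha_bound CARD('n) (card (all_neighbors Nb Byz i t)) (\<sigma> i t))
        (w i t)"
  shows "network_redundancy (f - CARD('n) * \<kappa>bar)
    (redundancy_graph (alpha_min CARD('n) m Nb Byz \<sigma>) m Nb w)"
proof -
  let ?K = "CARD('n) * \<kappa>bar"
  let ?a = "alpha_min CARD('n) m Nb Byz \<sigma>"
  let ?G = "normal_graph m Nb"
  let ?H = "redundancy_graph ?a m Nb w"
  \<comment> \<open>A bound uniform in \<open>i\<close> and \<open>t\<close>, from which
    \<open>alpha_min\<close> is a genuine minimum.\<close>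
  have D: "card (all_neighbors Nb Byz i t) \<le> m + \<kappa>bar" if "i \<in> {1..m}" "1 \<le> t" for i t
  proof -
    have "card (Nb i t) \<le> m"
      using neighbors that card_mono[of "{1..m}" "Nb i t"] by simp
    moreover have "card (Byz i t) \<le> \<kappa>bar"
      using byzantine that by blast
    ultimately show ?thesis
      unfolding all_neighbors_def using card_Un_le[of "Nb i t" "Byz i t"] by linarith
  qed
  have sigma_le: "\<sigma> i t \<le> card (all_neighbors Nb Byz i t)" if "i \<in> {1..m}" "1 \<le> t" for i t
    using algorithm that unfolding algorithm_output_def by fastforce
  have root_set: "rooted (?H t) \<and> f - ?K \<le> card (roots (?H t))" if t: "1 \<le> t" for t
  proof -
    have nb: "Nb i t \<subseteq> {1..m}" "i \<in> Nb i t" "finite (Nb i t)" if "i \<in> {1..m}" for i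
      using neighbors t that finite_subset[of "Nb i t" "{1..m}"] by auto
    have verts: "verts (?G t) = {1..m}" "verts (?H t) = {1..m}"
      by (simp_all add: normal_graph_def redundancy_graph_def)
    have sub: "subgraph F (?G t)"
      using core t by blast
    have F_verts: "verts F \<subseteq> {1..m}"
      using sub verts(1) by (auto simp: subgraph_def)
    have loss: "card (in_neighbors (?G t) i - in_neighbors (?H t) i) \<le> ?K" if i: "i \<in> {1..m}" for i
    proof -
      have pos: "0 < ?a"
        and le: "?a \<le> alpha_bound CARD('n) (card (all_neighbors Nb Byz i t)) (\<sigma> i t)"
        using alpha_min_bounds[OF D sigma_le i t] by blast+
      have byz: "finite (Byz i t)" "Byz i t \<inter> {1..m} = {}" "card (Byz i t) \<le> \<kappa>bar"
        using byzantine t i by blast+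
      have ow: "output_weights (Nb i t) (\<lambda>j. x j t) (v i t)
          (gamma_bound (card (Nb i t \<union> Byz i t)) (card (Byz i t)) (CARD('n) * card (Byz i t) + 2))
          (alpha_bound CARD('n) (card (all_neighbors Nb Byz i t)) (\<sigma> i t)) (w i t)"
        using weights sigma t i by (simp add: all_neighbors_def)
      \<comment> \<open>Because \<open>?a\<close> is positive, a weight of at least
        \<open>?a\<close> is non-zero; thus exactly the arcs of weight below \<open>?a\<close> are
        lost.\<close>
      have "in_neighbors (?G t) i - in_neighbors (?H t) i = {j \<in> Nb i t. w i t j < ?a}"
        using pos by (auto simp: in_neighbors_normal_graph[OF i] in_neighbors_redundancy_graph[OF i])
      also have "card \<dots> \<le> CARD('n) * card (Byz i t)"
        using ow nb(3)[OF i] byz(1) _ le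
        by (rule output_weights_card_small) (use nb(1)[OF i] byz(2) in blast)
      also have "\<dots> \<le> ?K"
        using byz(3) by simp
      finally show ?thesis .
    qed
    \<comment> \<open>Completeness of \<open>F\<close> does not provide loops, so
      \<open>insert i\<close> covers the case \<open>j = i\<close>.\<close>
    have complete: "verts F \<subseteq> insert i (in_neighbors (?G t) i)" if "i \<in> verts F" for i
    proof
      fix j
      assume "j \<in> verts F"
      then have "j = i \<or> j \<rightarrow>\<^bsub>F\<^esub> i"
        using core_complete that unfolding fully_connected_def by blast
      then show "j \<in> insert i (in_neighbors (?G t) i)"
        using pre_digraph.adj_mono[OF _ sub] by (auto simp: in_neighbors_def)
    qed
    \<comment> \<open>Here the size \<open>f \<ge> 2 * CARD('n) * \<kappa>bar + 1\<close> enters: it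
      forces in-closed sets to meet inside the core.\<close>
    have large: "2 * ?K < card (verts F)"
      using core_card by simp
    have wf: "wf_digraph (?H t)"
      using nb(1) by (rule wf_digraph_redundancy_graph)
    have outside: "r_reachable_set (?K + 1) (?G t) A"
      if "A \<noteq> {}" "A \<subseteq> {1..m} - verts F" for A
      using outside_core[rule_format, OF t, of A] that by (simp only: verts simp_thms)
    have fin: "finite (in_neighbors (?G t) i)" if "i \<in> {1..m}" for i
      using nb(3)[OF that] by (simp only: in_neighbors_normal_graph[OF that])
    note root_set = large_root_set[where G = "?G t" and H = "?H t" and C = "verts F" and K = ?K,
        unfolded verts, OF wf finite_atLeastAtMost refl fin loss F_verts complete large outside]
    have "rooted (?H t)" "card (verts F) - ?K \<le> card (roots (?H t))"
      by (rule root_set, assumption+)+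
    then show ?thesis
      using core_card(1) by simp
  qed
  show ?thesis
    by (rule network_redundancy_every_time) (use root_set in blast)+
qed

end
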